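(* Let $(b_n)_{n\ge 0}$ be the sequence defined by $b_0=3$ and $b_n-b_{n-1}=5\cdot 2^{2n-1}$ for all $n\ge 1$. Then $b_n=\frac{1}{3}\left[5\cdot 2^{2n+1}-1\right]$ for all $n\ge 0$; for every odd number in the set $\{b_n : n\ge 0\}$, repeated application of the Collatz function $f$ eventually reaches $1$; and for each $n\ge 0$ the number of Collatz function operations needed to get $1$ from $b_n$ is $N_{b_n}=N_5+2n+2$.
   Context: The Collatz function $f:\mathbb{Z}_{\ge 1}\to\mathbb{Z}_{\ge 1}$ is defined by $f(n)=n/2$ if $n$ is even and $f(n)=3n+1$ if $n$ is odd. For a positive integer $k$, $N_k$ denotes the number of Collatz function operations for the number $k$ to get $1$, i.e. the least integer $m\ge 1$ such that the $m$-fold iterate satisfies $f^{m}(k)=1$ (so that $N_1=3$, via $1\to 4\to 2\to 1$), with $N_k=\infty$ if there is no such $m$. *)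

theory Defs
  imports Complex_Main "HOL-Library.Extended_Nat"
begin

text \<open>
  The Collatz function has domain and codomain the positive integers, which it maps to themselves.
  It is totalised to type \<open>int\<close>; the values at arguments below 1 carry no meaning.
\<close>

definition collatz :: "int \<Rightarrow> int" where
  "collatz n = (if even n then n div 2 else 3 * n + 1)"

definition reaches_one_in :: "int \<Rightarrow> nat \<Rightarrow> bool" where
  "reaches_one_in k m \<longleftrightarrow> m \<ge> 1 \<and> (collatz ^^ m) k = 1"

text \<open>
  At least one operation is required, so the count for 1 is 3 (via 1, 4, 2, 1) and not 0.
\<close>

definition collatz_count :: "int \<Rightarrow> enat" where
  "collatz_count k =
     (if \<exists>m. reaches_one_in k m then enat (LEAST m. reaches_one_in k m) else \<infinity>)"

end

theory Submission
  imports Defs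
begin

text \<open>
  Telescoping the recurrence gives \<open>3 b\<^sub>n + 1 = 5 \<cdot> 2\<^bsup>2n+1\<^esup>\<close>. Hence every \<open>b\<^sub>n\<close> is odd, one
  odd step sends it to \<open>5 \<cdot> 2\<^bsup>2n+1\<^esup>\<close>, and \<open>2n + 1\<close> halvings lead from there to \<open>5\<close>. No
  value strictly between \<open>b\<^sub>n\<close> and \<open>5\<close> on this path is \<open>1\<close>, so exactly \<open>2n + 2\<close> operations
  are added to the count for \<open>5\<close> (\<open>collatz_count_step\<close>, \<open>collatz_count_power_2_mult\<close>). That count
  is finite because \<open>5 \<rightarrow> 16 \<rightarrow> 8 \<rightarrow> 4 \<rightarrow> 2 \<rightarrow> 1\<close>, so every \<open>b\<^sub>n\<close> reaches \<open>1\<close>.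
\<close>

lemma collatz_count_eq_infinity_iff:
  "collatz_count k = \<infinity> \<longleftrightarrow> (\<nexists>m. reaches_one_in k m)"
  by (simp add: collatz_count_def)

lemma reaches_one_in_Suc:
  assumes "collatz k \<noteq> 1"
  shows "reaches_one_in k (Suc m) \<longleftrightarrow> reaches_one_in (collatz k) m"
  using assms by (cases m) (auto simp: reaches_one_in_def funpow_swap1)

text \<open>
  The orbit of \<open>k\<close> is \<open>k\<close> followed by the orbit of \<open>collatz k\<close>. If \<open>collatz k = 1\<close>
  the left-hand side is 1, whereas the count for 1 itself is 3; this is why that case is excluded.
\<close>

lemma collatz_count_step:
  assumes "collatz k \<noteq> 1"
  shows "collatz_count k = eSuc (collatz_count (collatz k))"
proof -
  have not_zero: "\<not> reaches_one_in k 0"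
    by (simp add: reaches_one_in_def)
  note suc = reaches_one_in_Suc[OF assms]
  show ?thesis
  proof (cases "\<exists>m. reaches_one_in (collatz k) m")
    case True
    then obtain m where "reaches_one_in k (Suc m)"
      using suc by blast
    then have "(LEAST m. reaches_one_in k m) = Suc (LEAST m. reaches_one_in (collatz k) m)"
      using Least_Suc[of "reaches_one_in k" "Suc m"] not_zero suc by simp
    with True \<open>reaches_one_in k (Suc m)\<close> show ?thesis
      by (auto simp: collatz_count_def eSuc_enat)
  next
    case False
    then have "\<not> reaches_one_in k m" for m
      using not_zero suc by (cases m) auto
    with False show ?thesis
      by (simp add: collatz_count_def)
  qed
qed

lemma collatz_count_power_2_mult:
  assumes "k > 1"
  shows "collatz_count (k * 2 ^ m) = collatz_count k + enat m"
proof (induction m)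
  case 0
  then show ?case by (simp flip: zero_enat_def)
next
  case (Suc m)
  have "collatz (k * 2 ^ Suc m) = k * 2 ^ m"
    by (simp add: collatz_def)
  moreover have "k * 2 ^ m > 1"
    using assms by (simp add: less_1_mult' order_less_le_trans[OF assms])
  ultimately have "collatz_count (k * 2 ^ Suc m) = eSuc (collatz_count (k * 2 ^ m))"
    using collatz_count_step[of "k * 2 ^ Suc m"] by simp
  also have "\<dots> = collatz_count k + enat (Suc m)"
    by (simp add: Suc.IH iadd_Suc_right flip: eSuc_enat)
  finally show ?case .
qed

lemma reaches_one_from_5: "reaches_one_in 5 5"
  by (simp add: reaches_one_in_def collatz_def eval_nat_numeral)

theorem theorem2:
  fixes b :: "nat \<Rightarrow> int"
  assumes "b 0 = 3"
    and "\<And>n. n \<ge> 1 \<Longrightarrow> b n - b (n - 1) = 5 * 2 ^ (2 * n - 1)"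
  shows "(\<forall>n. real_of_int (b n) = 1 / 3 * (5 * 2 ^ (2 * n + 1) - 1)) \<and>
    (\<forall>k \<in> {b n | n. n \<ge> 0}. odd k \<longrightarrow> (\<exists>m. reaches_one_in k m)) \<and>
    (\<forall>n. collatz_count (b n) = collatz_count 5 + enat (2 * n + 2))"
proof -
  have closed_form: "3 * b n + 1 = 5 * 2 ^ (2 * n + 1)" for n
  proof (induction n)
    case 0
    show ?case using assms(1) by simp
  next
    case (Suc n)
    have "b (Suc n) = b n + 5 * 2 ^ (2 * n + 1)"
      using assms(2)[of "Suc n"] by simp
    with Suc show ?case by simp
  qed
  have formula: "real_of_int (b n) = 1 / 3 * (5 * 2 ^ (2 * n + 1) - 1)" for n
  proof -
    have "real_of_int (3 * b n + 1) = real_of_int (5 * 2 ^ (2 * n + 1))"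
      by (simp only: closed_form)
    then show ?thesis by simp
  qed
  have count: "collatz_count (b n) = collatz_count 5 + enat (2 * n + 2)" for n
  proof -
    have "even (3 * b n + 1)"
      unfolding closed_form by simp
    then have "odd (b n)"
      by simp
    then have step: "collatz (b n) = 5 * 2 ^ (2 * n + 1)"
      using closed_form[of n] by (simp add: collatz_def)
    \<comment> \<open>The right-hand side of the step is even, hence not \<open>1\<close>.\<close>
    moreover have "(5 * 2 ^ (2 * n + 1) :: int) \<noteq> 1"
      by (metis dvd_triv_left even_mult_iff odd_one power_add power_one_right)
    ultimately have "collatz_count (b n) = eSuc (collatz_count (5 * 2 ^ (2 * n + 1)))"
      using collatz_count_step[of "b n"] by simp
    also have "\<dots> = collatz_count 5 + enat (2 * n + 2)"
      using collatz_count_power_2_mult[of 5 "2 * n + 1"]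
      by (simp add: iadd_Suc_right flip: eSuc_enat)
    finally show ?thesis .
  qed
  have "\<exists>m. reaches_one_in (b n) m" for n
  proof -
    have "collatz_count 5 \<noteq> \<infinity>"
      using reaches_one_from_5 collatz_count_eq_infinity_iff by blast
    then have "collatz_count (b n) \<noteq> \<infinity>"
      by (simp add: count plus_eq_infty_iff_enat)
    then show ?thesis
      by (simp add: collatz_count_eq_infinity_iff)
  qed
  with formula count show ?thesis by blast
qed

end
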